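(* Let $d$ be a positive integer and let $M\in\mathbb{C}^{d\times d}$ be a Hermitian matrix with eigenvalues $\lambda_1\ge\cdots\ge\lambda_d$ and corresponding orthonormal eigenvectors $V_1,\dots,V_d$. Let $c\in\mathbb{R}$, $a\in\mathbb{C}^d$, and let $A\in\mathbb{C}^{(d+1)\times(d+1)}$ be the Hermitian matrix $$A=\begin{bmatrix} c & a^*\\ a & M\end{bmatrix}.$$ Set $\eta_1=|c-\lambda_1|$. Then $$\frac{2|\langle a,V_1\rangle|^2}{\eta_1+\sqrt{\eta_1^2+4|\langle a,V_1\rangle|^2}}\ \le\ \lambda_1(A)-\max(c,\lambda_1)\ \le\ \frac{2\|a\|_2^2}{\eta_1+\sqrt{\eta_1^2+4\|a\|_2^2}}.$$
   Context: For a Hermitian matrix $B$ of size $m$, its eigenvalues, counted with multiplicity, are denoted $\lambda_1(B)\ge\cdots\ge\lambda_m(B)$; thus $\lambda_1(A)$ is the largest eigenvalue of $A$, while $\lambda_j$ without argument denotes $\lambda_j(M)$. $\langle\cdot,\cdot\rangle$ is the standard Hermitian inner product on $\mathbb{C}^d$, $\|\cdot\|_2$ is the Euclidean norm, and $a^*$ is the conjugate transpose of $a$. A fraction of the form $\frac{2t^2}{\eta_1+\sqrt{\eta_1^2+4t^2}}$ with $t\ge 0$ is understood as $0$ when $\eta_1=t=0$ (in all cases it equals $\frac12\left(\sqrt{\eta_1^2+4t^2}-\eta_1\right)$). *)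

theory Defs
  imports
    "Jordan_Normal_Form.Char_Poly"
    "Jordan_Normal_Form.Schur_Decomposition"
    "HOL-Analysis.L2_Norm"
begin

definition hermitian_mat :: "complex mat \<Rightarrow> bool" where
  "hermitian_mat B \<longleftrightarrow> square_mat B \<and> mat_adjoint B = B"

text \<open>The eigenvalues, repeated according to their multiplicity as roots of the characteristic
  polynomial, in decreasing order. This is meant for Hermitian matrices only: their eigenvalues are
  real, so taking \<^const>\<open>Re\<close> merely changes the type from complex to real.\<close>

definition eigvals_desc :: "complex mat \<Rightarrow> real list" where
  "eigvals_desc B = rev (sorted_list_of_multiset (image_mset Re (proots (char_poly B))))"

text \<open>Indexed from 1: \<open>eigval 1 B\<close> is the largest eigenvalue and \<open>eigval m B\<close> the smallest one of
  a Hermitian matrix of size \<open>m\<close>.\<close>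

definition eigval :: "nat \<Rightarrow> complex mat \<Rightarrow> real" where
  "eigval k B = eigvals_desc B ! (k - 1)"

definition norm2 :: "complex vec \<Rightarrow> real" where
  "norm2 v = L2_set (\<lambda>i. cmod (v $ i)) {..<dim_vec v}"

definition bordered_mat :: "real \<Rightarrow> complex vec \<Rightarrow> complex mat \<Rightarrow> complex mat" where
  "bordered_mat c a M =
     (let col = mat_of_cols (dim_vec a) [a]
      in four_block_mat (mat 1 1 (\<lambda>_. complex_of_real c)) (mat_adjoint col) col M)"

end

theory Submission
  imports Defs
begin

text \<open>
  Write \<open>a\<^sub>j = \<langle>a, V\<^sub>j\<rangle>\<close> and \<open>\<lambda>\<^sub>j\<close> for the eigenvalues of \<open>M\<close>. In the eigenbasis of \<open>M\<close> the matrix \<open>A\<close>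
  is an arrowhead matrix (lemma \<open>eigenvalue_bordered_iff\<close>), so the eigenvalues of \<open>A\<close> to the right of
  \<open>\<lambda>\<^sub>1\<close> are the solutions of the secular equation \<open>z - c = (\<Sum>j. \<bar>a\<^sub>j\<bar>\<^sup>2 / (z - \<lambda>\<^sub>j))\<close>.

  For the upper bound, every denominator is at least \<open>z - \<lambda>\<^sub>1\<close>, and \<open>\<Sum>j. \<bar>a\<^sub>j\<bar>\<^sup>2\<close> is the square of
  the norm of \<open>a\<close>. Hence \<open>(z - c) (z - \<lambda>\<^sub>1) \<le> \<parallel>a\<parallel>\<^sup>2\<close> for each eigenvalue \<open>z\<close> of \<open>A\<close> beyond \<open>\<lambda>\<^sub>1\<close>
  (lemma \<open>eigenvalue_bordered_le\<close>). For the lower bound, let \<open>s\<close> be the larger solution of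
  \<open>(s - c) (s - \<lambda>\<^sub>1) = \<bar>a\<^sub>1\<bar>\<^sup>2\<close>. If \<open>s > \<lambda>\<^sub>1\<close>, the first term alone makes the right-hand side of the
  secular equation at least the left-hand side at \<open>s\<close>, so the equation has a root in \<open>[s, \<infinity>)\<close>
  (lemma \<open>secular_root\<close>), which is an eigenvalue of \<open>A\<close> (lemma \<open>eigenvalue_borderedI\<close>). In the
  remaining case \<open>s = \<lambda>\<^sub>1\<close> and \<open>a\<^sub>1 = 0\<close>, so that \<open>\<lambda>\<^sub>1\<close> is itself an eigenvalue of \<open>A\<close>.

  Both bounds are statements about the same quadratic: with \<open>u = z - max c \<lambda>\<^sub>1\<close> the product
  \<open>(z - c) (z - \<lambda>\<^sub>1)\<close> equals \<open>u (u + \<eta>\<^sub>1)\<close>, and the fractions of the theorem are the nonnegative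
  roots of \<open>u (u + \<eta>\<^sub>1) = T\<close> for \<open>T = \<bar>a\<^sub>1\<bar>\<^sup>2\<close> and \<open>T = \<parallel>a\<parallel>\<^sup>2\<close> (lemma \<open>shift_root\<close>).
\<close>

section \<open>The largest eigenvalue\<close>

text \<open>The characteristic polynomial splits over \<open>\<complex>\<close>, so the list of real parts of eigenvalues is not
empty, and its first entry in decreasing order is their maximum. Bounding \<^term>\<open>eigval 1 A\<close> thus
means bounding the real part of each eigenvalue of \<open>A\<close> from above and exhibiting one that is large.\<close>

lemma eigval_1_max:
  assumes B: "B \<in> carrier_mat n n" and n: "n > 0"
  shows "\<exists>z. eigenvalue B z \<and> Re z = eigval 1 B"
    and "eigenvalue B z \<Longrightarrow> Re z \<le> eigval 1 B"
proof -
  have cp: "degree (char_poly B) = n" "char_poly B \<noteq> 0"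
    using degree_monic_char_poly[OF B] by auto
  let ?R = "image_mset Re (proots (char_poly B))"
  let ?xs = "sorted_list_of_multiset ?R"
  have ne: "?xs \<noteq> []"
    using size_proots_complex[of "char_poly B"] cp(1) n
    by (metis mset_sorted_list_of_multiset mset.simps(1) size_image_mset size_empty less_irrefl)
  have set: "set ?xs = Re ` {z. eigenvalue B z}"
    using cp(2) by (simp add: eigenvalue_root_char_poly[OF B])
  have ev: "eigval 1 B = last ?xs"
    using ne by (simp add: eigval_def eigvals_desc_def rev_nth last_conv_nth)
  show "\<exists>z. eigenvalue B z \<and> Re z = eigval 1 B"
    using last_in_set[OF ne] unfolding ev set by auto
  assume z: "eigenvalue B z"
  then have "Re z \<in> set ?xs" unfolding set by auto
  then obtain i where i: "i < length ?xs" "?xs ! i = Re z"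
    unfolding in_set_conv_nth by blast
  show "Re z \<le> eigval 1 B"
    using sorted_nth_mono[of ?xs i "length ?xs - 1"] i ne unfolding ev last_conv_nth[OF ne]
    by auto
qed

section \<open>Coordinates in an orthonormal eigenbasis\<close>

lemma cscalar_prod_sum:
  "w \<in> carrier_vec n \<Longrightarrow> v \<bullet>c w = (\<Sum>i<n. v $ i * cnj (w $ i))"
  by (auto simp: scalar_prod_def atLeast0LessThan)

lemma norm2_square: "complex_of_real ((norm2 v)\<^sup>2) = v \<bullet>c v"
  by (simp add: cscalar_prod_sum[OF carrier_vec_dim_vec] norm2_def L2_set_def sum_nonneg
      complex_mult_cnj cmod_power2)

lemma hermitian_mat_index:
  assumes "M \<in> carrier_mat d d" "hermitian_mat M" "i < d" "k < d"
  shows "M $$ (i, k) = cnj (M $$ (k, i))"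
proof -
  have "M $$ (i, k) = mat_adjoint M $$ (i, k)" using assms(2) by (simp add: hermitian_mat_def)
  also have "\<dots> = cnj (M $$ (k, i))"
    using assms(1,3,4) by (simp add: mat_adjoint_def mat_of_rows_def)
  finally show ?thesis .
qed

lemma hermitian_mat_symmetric:
  assumes M: "M \<in> carrier_mat d d" "hermitian_mat M" and v: "v \<in> carrier_vec d"
    and w: "w \<in> carrier_vec d"
  shows "(M *\<^sub>v v) \<bullet>c w = v \<bullet>c (M *\<^sub>v w)"
proof -
  have entry: "M $$ (i, k) * v $ k * cnj (w $ i) = v $ k * cnj (M $$ (k, i) * w $ i)"
    if "i < d" "k < d" for i k
    using hermitian_mat_index[OF M that] by simp
  have "(M *\<^sub>v v) \<bullet>c w = (\<Sum>i<d. \<Sum>k<d. M $$ (i, k) * v $ k * cnj (w $ i))"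
    unfolding cscalar_prod_sum[OF w] using M(1) v
    by (simp add: scalar_prod_def atLeast0LessThan sum_distrib_right)
  also have "\<dots> = (\<Sum>k<d. \<Sum>i<d. v $ k * cnj (M $$ (k, i) * w $ i))"
    by (subst sum.swap) (auto intro!: sum.cong simp: entry)
  also have "\<dots> = v \<bullet>c (M *\<^sub>v w)"
    unfolding cscalar_prod_sum[OF mult_mat_vec_carrier[OF M(1) w]] using M(1) w
    by (simp add: scalar_prod_def atLeast0LessThan sum_distrib_left)
  finally show ?thesis .
qed

locale orthonormal_eigenbasis =
  fixes d :: nat and M :: "complex mat" and V :: "nat \<Rightarrow> complex vec" and ev :: "nat \<Rightarrow> real"
  assumes M: "M \<in> carrier_mat d d" "hermitian_mat M"
    and eigenvectors: "\<And>j. j \<in> {1..d} \<Longrightarrow> eigenvector M (V j) (complex_of_real (ev j))"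
    and orthonormal: "\<And>i j. i \<in> {1..d} \<Longrightarrow> j \<in> {1..d} \<Longrightarrow> V i \<bullet>c V j = (if i = j then 1 else 0)"
begin

lemma V_carrier: "j \<in> {1..d} \<Longrightarrow> V j \<in> carrier_vec d"
  using eigenvectors[of j] M(1) by (auto simp: eigenvector_def)

text \<open>A square matrix with orthonormal columns is unitary, hence its rows are orthonormal as well.\<close>

lemma completeness:
  assumes "i < d" "k < d"
  shows "(\<Sum>j\<in>{1..d}. V j $ i * cnj (V j $ k)) = (if i = k then 1 else 0)"
proof -
  define U where "U = mat d d (\<lambda>(i, j). V (Suc j) $ i)"
  define W where "W = mat d d (\<lambda>(j, k). cnj (V (Suc j) $ k))"
  have UW: "U \<in> carrier_mat d d" "W \<in> carrier_mat d d" by (auto simp: U_def W_def)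
  have "W * U = 1\<^sub>m d"
  proof (rule eq_matI)
    fix i j assume ij: "i < dim_row (1\<^sub>m d)" "j < dim_col (1\<^sub>m d)"
    then have "(W * U) $$ (i, j) = V (Suc j) \<bullet>c V (Suc i)"
      using V_carrier[of "Suc i"]
      by (simp add: U_def W_def cscalar_prod_sum scalar_prod_def atLeast0LessThan mult.commute)
    also have "\<dots> = 1\<^sub>m d $$ (i, j)" using ij orthonormal[of "Suc j" "Suc i"] by auto
    finally show "(W * U) $$ (i, j) = 1\<^sub>m d $$ (i, j)" .
  qed (use UW in auto)
  then have "U * W = 1\<^sub>m d" using mat_mult_left_right_inverse[OF UW(2,1)] by simp
  then have "(U * W) $$ (i, k) = (if i = k then 1 else 0)" using assms by simp
  moreover have "(U * W) $$ (i, k) = (\<Sum>j<d. V (Suc j) $ i * cnj (V (Suc j) $ k))"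
    using assms by (simp add: U_def W_def scalar_prod_def atLeast0LessThan)
  ultimately show ?thesis
    by (simp add: sum.atLeast1_atMost_eq)
qed

lemma parseval:
  assumes v: "v \<in> carrier_vec d" and w: "w \<in> carrier_vec d"
  shows "v \<bullet>c w = (\<Sum>j\<in>{1..d}. (v \<bullet>c V j) * cnj (w \<bullet>c V j))"
proof -
  have "(\<Sum>j\<in>{1..d}. (v \<bullet>c V j) * cnj (w \<bullet>c V j))
    = (\<Sum>j\<in>{1..d}. \<Sum>k<d. \<Sum>i<d. v $ k * cnj (w $ i) * (V j $ i * cnj (V j $ k)))"
    by (intro sum.cong refl)
      (simp add: cscalar_prod_sum[OF V_carrier] sum_product cnj_sum mult_ac)
  also have "\<dots> = (\<Sum>k<d. \<Sum>j\<in>{1..d}. \<Sum>i<d. v $ k * cnj (w $ i) * (V j $ i * cnj (V j $ k)))"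
    by (rule sum.swap)
  also have "\<dots> = (\<Sum>k<d. \<Sum>i<d. \<Sum>j\<in>{1..d}. v $ k * cnj (w $ i) * (V j $ i * cnj (V j $ k)))"
    by (intro sum.cong refl sum.swap)
  also have "\<dots> = (\<Sum>k<d. \<Sum>i<d. v $ k * cnj (w $ i) * (\<Sum>j\<in>{1..d}. V j $ i * cnj (V j $ k)))"
    by (simp only: sum_distrib_left)
  also have "\<dots> = (\<Sum>k<d. \<Sum>i<d. if i = k then v $ k * cnj (w $ i) else 0)"
    using completeness by (intro sum.cong refl) (simp del: One_nat_def)
  also have "\<dots> = v \<bullet>c w" by (simp add: cscalar_prod_sum[OF w])
  finally show ?thesis by simp
qed

lemma norm2_square_coordinates:
  assumes "v \<in> carrier_vec d"
  shows "(norm2 v)\<^sup>2 = (\<Sum>j\<in>{1..d}. (cmod (v \<bullet>c V j))\<^sup>2)"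
proof -
  have "complex_of_real ((norm2 v)\<^sup>2) = complex_of_real (\<Sum>j\<in>{1..d}. (cmod (v \<bullet>c V j))\<^sup>2)"
    unfolding norm2_square parseval[OF assms assms] of_real_sum complex_norm_square by simp
  then show ?thesis using of_real_eq_iff by blast
qed

lemma eq_iff_coordinates_eq:
  assumes v: "v \<in> carrier_vec d" and w: "w \<in> carrier_vec d"
  shows "v = w \<longleftrightarrow> (\<forall>j\<in>{1..d}. v \<bullet>c V j = w \<bullet>c V j)"
proof
  assume eq: "\<forall>j\<in>{1..d}. v \<bullet>c V j = w \<bullet>c V j"
  have "(v - w) \<bullet>c V j = 0" if "j \<in> {1..d}" for j
    using minus_scalar_prod_distrib[OF v w, of "conjugate (V j)"] V_carrier[OF that] eq that by simp
  then have "(v - w) \<bullet>c (v - w) = 0" using v w by (subst parseval) auto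
  then have *: "v - w = 0\<^sub>v d" using v w by (subst (asm) conjugate_square_eq_0_vec[of _ d]) auto
  show "v = w"
  proof (rule eq_vecI)
    fix i assume "i < dim_vec w"
    then show "v $ i = w $ i" using arg_cong[OF *, of "\<lambda>u. u $ i"] v w by simp
  qed (use v w in auto)
qed simp

lemma vec_with_coordinates:
  obtains v where "v \<in> carrier_vec d" "\<And>j. j \<in> {1..d} \<Longrightarrow> v \<bullet>c V j = \<beta> j"
proof
  define v where "v = vec d (\<lambda>i. \<Sum>j\<in>{1..d}. \<beta> j * V j $ i)"
  show "v \<in> carrier_vec d" by (simp add: v_def)
  fix k assume k: "k \<in> {1..d}"
  have "v \<bullet>c V k = (\<Sum>i<d. \<Sum>j\<in>{1..d}. \<beta> j * V j $ i * cnj (V k $ i))"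
    by (simp add: cscalar_prod_sum[OF V_carrier[OF k]] v_def sum_distrib_right)
  also have "\<dots> = (\<Sum>j\<in>{1..d}. \<beta> j * (V j \<bullet>c V k))"
    by (subst sum.swap) (simp add: cscalar_prod_sum[OF V_carrier[OF k]] sum_distrib_left mult_ac)
  also have "\<dots> = \<beta> k"
    using k by (simp add: orthonormal if_distrib cong: if_cong)
  finally show "v \<bullet>c V k = \<beta> k" .
qed

lemma coordinate_mult_mat_vec:
  assumes v: "v \<in> carrier_vec d" and j: "j \<in> {1..d}"
  shows "(M *\<^sub>v v) \<bullet>c V j = complex_of_real (ev j) * (v \<bullet>c V j)"
  using hermitian_mat_symmetric[OF M v V_carrier[OF j]] eigenvectors[OF j] V_carrier[OF j] v
  by (simp add: eigenvector_def conjugate_smult_vec)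

end

section \<open>The scalar shift and the secular equation\<close>

lemma Re_inverse_le:
  assumes "0 < Re z"
  shows "Re (inverse z) \<le> 1 / Re z"
proof -
  have "Re (inverse z) \<le> 1 / cmod z"
    using complex_Re_le_cmod[of "inverse z"] by (simp add: norm_inverse divide_inverse)
  also have "\<dots> \<le> 1 / Re z"
    using assms complex_Re_le_cmod[of z] by (intro divide_left_mono mult_pos_pos) auto
  finally show ?thesis .
qed

text \<open>This is the secular equation of a bordered matrix with squared border coordinates \<open>w j\<close>. At \<open>s\<close>
the sum is at least its term for the pole \<open>k\<close>, hence at least \<open>s - c\<close>; far to the right it is
bounded while \<open>\<mu> - c\<close> grows. There are no poles in between, so the intermediate value theorem
applies.\<close>

lemma secular_root:
  fixes w ev :: "nat \<Rightarrow> real"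
  assumes "finite J" and w: "\<And>j. j \<in> J \<Longrightarrow> 0 \<le> w j" and top: "\<And>j. j \<in> J \<Longrightarrow> ev j \<le> ev k"
    and k: "k \<in> J" and start: "ev k < s" "(s - c) * (s - ev k) \<le> w k"
  shows "\<exists>\<mu>\<ge>s. \<mu> - c = (\<Sum>j\<in>J. w j / (\<mu> - ev j))"
proof -
  define f where "f \<mu> = \<mu> - c - (\<Sum>j\<in>J. w j / (\<mu> - ev j))" for \<mu>
  \<comment> \<open>To the right of \<open>ev k + 1\<close> all denominators are at least 1, so the sum is at most \<open>sum w J\<close>.\<close>
  define e where "e = max s (max (ev k + 1) (c + sum w J))"
  have pos: "ev j < s" if "j \<in> J" for j using top[OF that] start(1) by simp
  have "s - c \<le> w k / (s - ev k)" using start by (simp add: field_simps)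
  also have "\<dots> \<le> (\<Sum>j\<in>J. w j / (s - ev j))"
    using \<open>finite J\<close> k w pos by (intro member_le_sum) (auto intro!: divide_nonneg_pos)
  finally have "f s \<le> 0" by (simp add: f_def)
  moreover have "0 \<le> f e"
  proof -
    have "(\<Sum>j\<in>J. w j / (e - ev j)) \<le> sum w J"
    proof (rule sum_mono)
      fix j assume j: "j \<in> J"
      have "1 \<le> e - ev j" using top[OF j] by (simp add: e_def)
      then show "w j / (e - ev j) \<le> w j"
        using divide_left_mono[of 1 "e - ev j" "w j"] w[OF j] by simp
    qed
    then show ?thesis by (simp add: f_def e_def)
  qed
  moreover have "continuous_on {s..e} f"
    unfolding f_def using top start(1) by (intro continuous_intros) force
  ultimately obtain \<mu> where "s \<le> \<mu>" "f \<mu> = 0"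
    using IVT'[of f s 0 e] by (auto simp: e_def)
  then show ?thesis by (auto simp: f_def)
qed

text \<open>Rationalising the denominator shows that the fraction is the nonnegative root \<open>r\<close> of
\<open>r (r + \<eta>) = T\<close>. When \<open>\<eta> = T = 0\<close> the denominator vanishes and division by zero gives the correct
value 0.\<close>

lemma shift_root:
  fixes \<eta> T :: real
  assumes "0 \<le> \<eta>" "0 \<le> T"
  defines "r \<equiv> 2 * T / (\<eta> + sqrt (\<eta>\<^sup>2 + 4 * T))"
  shows "0 \<le> r" "r * (r + \<eta>) = T"
proof -
  let ?q = "sqrt (\<eta>\<^sup>2 + 4 * T)"
  have q: "?q * ?q = \<eta>\<^sup>2 + 4 * T" "0 \<le> ?q" using assms by auto
  have r: "r = (?q - \<eta>) / 2"
  proof (cases "\<eta> + ?q = 0")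
    case True
    then have "\<eta> = 0" "?q = 0" using assms q(2) by linarith+
    then show ?thesis by (simp add: r_def)
  next
    case False
    then show ?thesis using q(1) by (simp add: r_def field_simps power2_eq_square)
  qed
  show "0 \<le> r" using assms by (simp add: r_def)
  show "r * (r + \<eta>) = T" unfolding r using q(1) by (simp add: field_simps power2_eq_square)
qed

lemma le_shift_root:
  fixes \<eta> T u :: real
  assumes "0 \<le> \<eta>" "0 \<le> T" "u * (u + \<eta>) \<le> T"
  shows "u \<le> 2 * T / (\<eta> + sqrt (\<eta>\<^sup>2 + 4 * T))" (is "_ \<le> ?r")
proof (rule ccontr)
  assume "\<not> ?thesis"
  then have "?r * (?r + \<eta>) < u * (u + \<eta>)"
    using shift_root(1)[OF assms(1,2)] assms(1) by (intro mult_strict_mono') auto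
  then show False using shift_root(2)[OF assms(1,2)] assms(3) by simp
qed

text \<open>One of the two factors is \<open>u\<close> and the other one is \<open>u\<close> plus the distance of \<open>c\<close> and \<open>l\<close>. This
identity connects the quadratic estimates for eigenvalues of the bordered matrix with the quadratic
equation that defines the fraction.\<close>

lemma shift_factors:
  fixes c l u :: real
  shows "(max c l + u - c) * (max c l + u - l) = u * (u + \<bar>c - l\<bar>)"
  by (simp add: max_def abs_if algebra_simps)

section \<open>Eigenvalues of the bordered matrix\<close>

lemma bordered_mat_carrier:
  assumes "a \<in> carrier_vec d" "M \<in> carrier_mat d d"
  shows "bordered_mat c a M \<in> carrier_mat (Suc d) (Suc d)"
  using assms by (auto simp: bordered_mat_def Let_def mat_adjoint_def)

text \<open>The entry \<open>a\<^sup>* y\<close> of the top row is \<open>y \<bullet>c a\<close>, because \<open>\<bullet>c\<close> conjugates its second argument.\<close>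

lemma bordered_mat_mult_vec:
  assumes a: "a \<in> carrier_vec d" and M: "M \<in> carrier_mat d d" and y: "y \<in> carrier_vec d"
  shows "bordered_mat c a M *\<^sub>v (vec 1 (\<lambda>_. x) @\<^sub>v y)
    = vec 1 (\<lambda>_. complex_of_real c * x + y \<bullet>c a) @\<^sub>v (x \<cdot>\<^sub>v a + M *\<^sub>v y)"
proof -
  let ?col = "mat_of_cols (dim_vec a) [a]"
  let ?x = "vec 1 (\<lambda>_. x)"
  have col: "?col \<in> carrier_mat d 1" "mat_adjoint ?col \<in> carrier_mat 1 d"
    using a by (auto simp: mat_adjoint_def mat_of_cols_def)
  have cols: "cols ?col = [a]" using a by (intro cols_mat_of_cols) auto
  have "row (mat_adjoint ?col) 0 = conjugate a"
    using a unfolding mat_adjoint_def cols by (intro eq_vecI) (auto simp: mat_of_rows_def)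
  then have 1: "mat_adjoint ?col *\<^sub>v y = vec 1 (\<lambda>_. y \<bullet>c a)"
    using a y col by (intro eq_vecI) (auto simp: comm_scalar_prod[of _ d])
  have 2: "?col *\<^sub>v ?x = x \<cdot>\<^sub>v a"
    using a by (intro eq_vecI) (auto simp: scalar_prod_def mat_of_cols_def)
  have 3: "mat 1 1 (\<lambda>_. complex_of_real c) *\<^sub>v ?x = vec 1 (\<lambda>_. complex_of_real c * x)"
    by (intro eq_vecI) (auto simp: scalar_prod_def)
  have 4: "vec 1 (\<lambda>_. complex_of_real c * x) + vec 1 (\<lambda>_. y \<bullet>c a)
      = vec 1 (\<lambda>_. complex_of_real c * x + y \<bullet>c a)"
    by (intro eq_vecI) auto
  show ?thesis
    unfolding bordered_mat_def Let_def
    by (subst four_block_mat_mult_vec[OF _ col(2,1) M _ y]) (auto simp only: 1 2 3 4 mat_carrier vec_carrier)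
qed

context orthonormal_eigenbasis
begin

text \<open>In coordinates with respect to the eigenbasis the block \<open>M\<close> becomes diagonal, so the eigenvector
equation of the bordered matrix for a vector with top entry \<open>x\<close> and remaining coordinates \<open>\<beta>\<close>
turns into one scalar equation for the top row and one for each \<open>j\<close>, which involves only \<open>x\<close>
and \<open>\<beta> j\<close>.\<close>

lemma eigenvalue_bordered_iff:
  assumes a: "a \<in> carrier_vec d"
  shows "eigenvalue (bordered_mat c a M) z \<longleftrightarrow>
    (\<exists>x \<beta>. (x \<noteq> 0 \<or> (\<exists>j\<in>{1..d}. \<beta> j \<noteq> 0)) \<and>
      complex_of_real c * x + (\<Sum>j\<in>{1..d}. \<beta> j * cnj (a \<bullet>c V j)) = z * x \<and>
      (\<forall>j\<in>{1..d}. x * (a \<bullet>c V j) + complex_of_real (ev j) * \<beta> j = z * \<beta> j))"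
    (is "_ \<longleftrightarrow> (\<exists>x \<beta>. ?P x \<beta>)")
proof -
  have key: "eigenvector (bordered_mat c a M) (vec 1 (\<lambda>_. x) @\<^sub>v y) z \<longleftrightarrow> ?P x (\<lambda>j. y \<bullet>c V j)"
    if y: "y \<in> carrier_vec d" for x y
  proof -
    have zero: "vec 1 (\<lambda>_. x) @\<^sub>v y = 0\<^sub>v (Suc d) \<longleftrightarrow> x = 0 \<and> (\<forall>j\<in>{1..d}. y \<bullet>c V j = 0)"
    proof -
      have "0\<^sub>v (Suc d) = vec 1 (\<lambda>_. 0) @\<^sub>v (0\<^sub>v d :: complex vec)" by (rule eq_vecI) auto
      then have "vec 1 (\<lambda>_. x) @\<^sub>v y = 0\<^sub>v (Suc d) \<longleftrightarrow> vec 1 (\<lambda>_. x) = vec 1 (\<lambda>_. 0) \<and> y = 0\<^sub>v d"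
        by (simp only:) (rule append_vec_eq[of _ 1], auto)
      moreover have "vec 1 (\<lambda>_. x) = vec 1 (\<lambda>_. 0) \<longleftrightarrow> x = 0"
        by (auto simp: vec_eq_iff)
      ultimately show ?thesis
        using eq_iff_coordinates_eq[OF y, of "0\<^sub>v d"] V_carrier by auto
    qed
    have scaled: "z \<cdot>\<^sub>v (vec 1 (\<lambda>_. x) @\<^sub>v y) = vec 1 (\<lambda>_. z * x) @\<^sub>v (z \<cdot>\<^sub>v y)"
      using y by (intro eq_vecI) auto
    have tail: "(x \<cdot>\<^sub>v a + M *\<^sub>v y = z \<cdot>\<^sub>v y) \<longleftrightarrow>
        (\<forall>j\<in>{1..d}. x * (a \<bullet>c V j) + complex_of_real (ev j) * (y \<bullet>c V j) = z * (y \<bullet>c V j))"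
    proof -
      have "(x \<cdot>\<^sub>v a + M *\<^sub>v y) \<bullet>c V j = x * (a \<bullet>c V j) + complex_of_real (ev j) * (y \<bullet>c V j)"
        "(z \<cdot>\<^sub>v y) \<bullet>c V j = z * (y \<bullet>c V j)" if "j \<in> {1..d}" for j
        using a y M(1) V_carrier[OF that] coordinate_mult_mat_vec[OF y that]
        by (auto simp: add_scalar_prod_distrib[of _ d])
      then show ?thesis
        using a y M(1) by (subst eq_iff_coordinates_eq) auto
    qed
    have head: "vec 1 (\<lambda>_. c * x + y \<bullet>c a) = vec 1 (\<lambda>_. z * x) \<longleftrightarrow>
        complex_of_real c * x + (\<Sum>j\<in>{1..d}. (y \<bullet>c V j) * cnj (a \<bullet>c V j)) = z * x"
      unfolding parseval[OF y a] by (auto simp: vec_eq_iff)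
    have split: "vec 1 (\<lambda>_. c * x + y \<bullet>c a) @\<^sub>v (x \<cdot>\<^sub>v a + M *\<^sub>v y) = vec 1 (\<lambda>_. z * x) @\<^sub>v (z \<cdot>\<^sub>v y)
      \<longleftrightarrow> vec 1 (\<lambda>_. c * x + y \<bullet>c a) = vec 1 (\<lambda>_. z * x) \<and> x \<cdot>\<^sub>v a + M *\<^sub>v y = z \<cdot>\<^sub>v y"
      by (rule append_vec_eq[of _ 1]) auto
    have dim: "dim_row (bordered_mat c a M) = Suc d"
      using bordered_mat_carrier[OF a M(1), of c] by (rule carrier_matD)
    have carrier: "vec 1 (\<lambda>_. x) @\<^sub>v y \<in> carrier_vec (Suc d)" using y by (intro carrier_vecI) simp
    show ?thesis
      unfolding eigenvector_def dim scaled bordered_mat_mult_vec[OF a M(1) y] zero split head tail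
      using carrier by blast
  qed
  show ?thesis
  proof
    assume "eigenvalue (bordered_mat c a M) z"
    then obtain v where v: "eigenvector (bordered_mat c a M) v z" by (auto simp: eigenvalue_def)
    have vc: "v \<in> carrier_vec (1 + d)"
      using v bordered_mat_carrier[OF a M(1), of c] by (auto simp: eigenvector_def)
    have "vec_first v 1 = vec 1 (\<lambda>_. v $ 0)" by (rule eq_vecI) (auto simp: vec_first_def)
    then have "v = vec 1 (\<lambda>_. v $ 0) @\<^sub>v vec_last v d"
      using vec_first_last_append[OF vc] by simp
    with v have "?P (v $ 0) (\<lambda>j. vec_last v d \<bullet>c V j)"
      using key[of "vec_last v d" "v $ 0"] by simp
    then show "\<exists>x \<beta>. ?P x \<beta>"
      by (intro exI[of _ "v $ 0"] exI[of _ "\<lambda>j. vec_last v d \<bullet>c V j"])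
  next
    assume "\<exists>x \<beta>. ?P x \<beta>"
    then obtain x \<beta> where P: "?P x \<beta>" by blast
    obtain y where y: "y \<in> carrier_vec d" "\<And>j. j \<in> {1..d} \<Longrightarrow> y \<bullet>c V j = \<beta> j"
      using vec_with_coordinates[of \<beta>] by blast
    have "?P x (\<lambda>j. y \<bullet>c V j)" using P y(2) by simp
    then have "eigenvector (bordered_mat c a M) (vec 1 (\<lambda>_. x) @\<^sub>v y) z"
      unfolding key[OF y(1)] .
    then show "eigenvalue (bordered_mat c a M) z" by (auto simp: eigenvalue_def)
  qed
qed

text \<open>To the right of the spectrum of \<open>M\<close> the scalar equations can be solved for \<open>\<beta> j\<close>, which forces
\<open>x \<noteq> 0\<close> and leaves the secular equation \<open>z - c = (\<Sum>j. \<bar>a\<^sub>j\<bar>\<^sup>2 / (z - ev j))\<close>, where \<open>a\<^sub>j\<close> is the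
coordinate of \<open>a\<close>. Taking real parts and replacing each \<open>ev j\<close> by the upper bound \<open>l\<close> only
increases the sum.\<close>

lemma eigenvalue_bordered_le:
  assumes a: "a \<in> carrier_vec d" and z: "eigenvalue (bordered_mat c a M) z"
    and top: "\<And>j. j \<in> {1..d} \<Longrightarrow> ev j \<le> l" and l: "l < Re z"
  shows "(Re z - c) * (Re z - l) \<le> (norm2 a)\<^sup>2"
proof -
  obtain x \<beta> where nz: "x \<noteq> 0 \<or> (\<exists>j\<in>{1..d}. \<beta> j \<noteq> 0)"
    and first: "complex_of_real c * x + (\<Sum>j\<in>{1..d}. \<beta> j * cnj (a \<bullet>c V j)) = z * x"
    and rest: "\<And>j. j \<in> {1..d} \<Longrightarrow> x * (a \<bullet>c V j) + complex_of_real (ev j) * \<beta> j = z * \<beta> j"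
    using z unfolding eigenvalue_bordered_iff[OF a] by blast
  have nz': "z - ev j \<noteq> 0" if "j \<in> {1..d}" for j
    using top[OF that] l by (auto simp: complex_eq_iff)
  have \<beta>: "\<beta> j = x * (a \<bullet>c V j) / (z - ev j)" if "j \<in> {1..d}" for j
    using rest[OF that] nz'[OF that] by (simp add: field_simps)
  have x: "x \<noteq> 0" using nz \<beta> by auto
  have "x * (z - c) = x * (\<Sum>j\<in>{1..d}. (cmod (a \<bullet>c V j))\<^sup>2 / (z - ev j))"
    using first \<beta> by (simp add: sum_distrib_left complex_norm_square[symmetric] algebra_simps)
  then have "z - c = (\<Sum>j\<in>{1..d}. (cmod (a \<bullet>c V j))\<^sup>2 / (z - ev j))" using x by simp
  then have "Re z - c = (\<Sum>j\<in>{1..d}. Re ((cmod (a \<bullet>c V j))\<^sup>2 / (z - ev j)))"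
    by (metis Re_complex_of_real Re_sum minus_complex.simps(1))
  also have "\<dots> \<le> (\<Sum>j\<in>{1..d}. (cmod (a \<bullet>c V j))\<^sup>2 / (Re z - l))"
  proof (rule sum_mono)
    fix j assume j: "j \<in> {1..d}"
    have pos: "0 < Re z - l" "Re z - l \<le> Re z - ev j" using top[OF j] l by auto
    have "Re (inverse (z - ev j)) \<le> 1 / (Re z - ev j)"
      using Re_inverse_le[of "z - ev j"] pos by simp
    also have "\<dots> \<le> 1 / (Re z - l)" using pos by (intro divide_left_mono) auto
    finally have "(cmod (a \<bullet>c V j))\<^sup>2 * Re (inverse (z - ev j)) \<le> (cmod (a \<bullet>c V j))\<^sup>2 * (1 / (Re z - l))"
      by (intro mult_left_mono) auto
    then show "Re ((cmod (a \<bullet>c V j))\<^sup>2 / (z - ev j)) \<le> (cmod (a \<bullet>c V j))\<^sup>2 / (Re z - l)"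
      unfolding divide_inverse[of "complex_of_real _"] of_real_power[symmetric] Re_complex_of_real
      by (simp del: of_real_power)
  qed
  also have "\<dots> = (norm2 a)\<^sup>2 / (Re z - l)"
    by (simp add: norm2_square_coordinates[OF a] sum_divide_distrib)
  finally show ?thesis using l by (simp add: field_simps)
qed

text \<open>Conversely, a real root of the secular equation yields an eigenvector with top entry 1.\<close>

lemma eigenvalue_borderedI:
  assumes a: "a \<in> carrier_vec d" and top: "\<And>j. j \<in> {1..d} \<Longrightarrow> ev j < \<mu>"
    and root: "\<mu> - c = (\<Sum>j\<in>{1..d}. (cmod (a \<bullet>c V j))\<^sup>2 / (\<mu> - ev j))"
  shows "eigenvalue (bordered_mat c a M) (complex_of_real \<mu>)"
proof -
  define \<beta> where "\<beta> j = (a \<bullet>c V j) / complex_of_real (\<mu> - ev j)" for j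
  have "(\<Sum>j\<in>{1..d}. \<beta> j * cnj (a \<bullet>c V j)) = complex_of_real (\<mu> - c)"
    unfolding root \<beta>_def by (simp add: complex_norm_square[symmetric])
  moreover have "(a \<bullet>c V j) + complex_of_real (ev j) * \<beta> j = complex_of_real \<mu> * \<beta> j"
    if "j \<in> {1..d}" for j
  proof -
    have "complex_of_real (\<mu> - ev j) \<noteq> 0" using top[OF that] by (simp only: of_real_eq_0_iff)
    then have "complex_of_real (\<mu> - ev j) * \<beta> j = a \<bullet>c V j" by (simp add: \<beta>_def)
    then show ?thesis by (simp add: algebra_simps)
  qed
  ultimately show ?thesis
    unfolding eigenvalue_bordered_iff[OF a] by (intro exI[of _ 1] exI[of _ \<beta>]) auto
qed

text \<open>The eigenvector is \<open>V k\<close> itself, with a zero entry put on top.\<close>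

lemma eigenvalue_bordered_if_orthogonal:
  assumes a: "a \<in> carrier_vec d" and k: "k \<in> {1..d}" and "a \<bullet>c V k = 0"
  shows "eigenvalue (bordered_mat c a M) (complex_of_real (ev k))"
  unfolding eigenvalue_bordered_iff[OF a]
  using k assms(3)
  by (intro exI[of _ 0] exI[of _ "\<lambda>j. if j = k then 1 else 0"])
    (auto simp: if_distrib[of "\<lambda>u. u * _"] cong: if_cong)

end

section \<open>Bounds for the largest eigenvalue of the bordered matrix\<close>

theorem theorem3p1:
  fixes d :: nat and M A :: "complex mat" and V :: "nat \<Rightarrow> complex vec"
    and c \<eta>\<^sub>1 :: real and a :: "complex vec"
  assumes "d > 0"
    and "M \<in> carrier_mat d d" and "hermitian_mat M"
    and "\<And>j. j \<in> {1..d} \<Longrightarrow> eigenvector M (V j) (complex_of_real (eigval j M))"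
    and "\<And>i j. i \<in> {1..d} \<Longrightarrow> j \<in> {1..d} \<Longrightarrow> V i \<bullet>c V j = (if i = j then 1 else 0)"
    and "a \<in> carrier_vec d"
    and "A = bordered_mat c a M"
    and "\<eta>\<^sub>1 = \<bar>c - eigval 1 M\<bar>"
  shows "2 * (cmod (a \<bullet>c V 1))\<^sup>2 / (\<eta>\<^sub>1 + sqrt (\<eta>\<^sub>1\<^sup>2 + 4 * (cmod (a \<bullet>c V 1))\<^sup>2))
           \<le> eigval 1 A - max c (eigval 1 M)
       \<and> eigval 1 A - max c (eigval 1 M)
           \<le> 2 * (norm2 a)\<^sup>2 / (\<eta>\<^sub>1 + sqrt (\<eta>\<^sub>1\<^sup>2 + 4 * (norm2 a)\<^sup>2))"
proof -
  interpret orthonormal_eigenbasis d M V "\<lambda>j. eigval j M"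
    using assms by unfold_locales auto
  note a = \<open>a \<in> carrier_vec d\<close> and A = \<open>A = bordered_mat c a M\<close>
  define l where "l = eigval 1 M"
  have \<eta>: "\<eta>\<^sub>1 = \<bar>c - l\<bar>" "0 \<le> \<eta>\<^sub>1" using assms(8) by (auto simp: l_def)
  have one: "1 \<in> {1..d}" using \<open>d > 0\<close> by simp
  have top: "eigval j M \<le> l" if "j \<in> {1..d}" for j
    using eigval_1_max(2)[OF M(1) \<open>d > 0\<close>, of "complex_of_real (eigval j M)"] eigenvectors[OF that]
    by (auto simp: eigenvalue_def l_def)
  note A_max = eigval_1_max[OF bordered_mat_carrier[OF a M(1)] zero_less_Suc, of c, folded A]
  let ?T = "(cmod (a \<bullet>c V 1))\<^sup>2"
  let ?r = "2 * ?T / (\<eta>\<^sub>1 + sqrt (\<eta>\<^sub>1\<^sup>2 + 4 * ?T))"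
  have r: "0 \<le> ?r" "?r * (?r + \<eta>\<^sub>1) = ?T" using shift_root[OF \<eta>(2), of ?T] by auto
  \<comment> \<open>The secular equation is meaningful only to the right of \<open>l\<close>. The claimed lower bound fails to
    lie there only if \<open>c \<le> l\<close> and \<open>?r = 0\<close>; then \<open>V 1\<close> is orthogonal to \<open>a\<close>.\<close>
  have "\<exists>\<mu>\<ge>max c l + ?r. eigenvalue A (complex_of_real \<mu>)"
  proof (cases "l < max c l + ?r")
    case True
    have "(max c l + ?r - c) * (max c l + ?r - l) = ?T"
      unfolding shift_factors \<eta>(1)[symmetric] by (rule r(2))
    then obtain \<mu> where \<mu>: "max c l + ?r \<le> \<mu>"
      "\<mu> - c = (\<Sum>j\<in>{1..d}. (cmod (a \<bullet>c V j))\<^sup>2 / (\<mu> - eigval j M))"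
      using secular_root[of "{1..d}" "\<lambda>j. (cmod (a \<bullet>c V j))\<^sup>2" "\<lambda>j. eigval j M" 1 "max c l + ?r" c]
        True top one unfolding l_def by auto
    have "eigval j M < \<mu>" if "j \<in> {1..d}" for j using top[OF that] True \<mu>(1) by linarith
    then show ?thesis using eigenvalue_borderedI[OF a _ \<mu>(2)] \<mu>(1) unfolding A by blast
  next
    case False
    then have "max c l + ?r = l" "?r = 0" using r(1) by linarith+
    then have "a \<bullet>c V 1 = 0" using r(2) unfolding \<open>?r = 0\<close> by simp
    then show ?thesis
      using eigenvalue_bordered_if_orthogonal[OF a one] \<open>max c l + ?r = l\<close>
      unfolding A l_def by (intro exI[of _ "eigval 1 M"]) auto
  qed
  then have lower: "max c l + ?r \<le> eigval 1 A" using A_max(2) by fastforce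
  obtain z where z: "eigenvalue A z" "Re z = eigval 1 A" using A_max(1) by blast
  define u where "u = eigval 1 A - max c l"
  have "u * (u + \<eta>\<^sub>1) \<le> (norm2 a)\<^sup>2"
  proof (cases "l < eigval 1 A")
    case True
    have "u * (u + \<eta>\<^sub>1) = (Re z - c) * (Re z - l)"
      using shift_factors[of c l u] unfolding \<eta>(1)[symmetric] by (simp add: u_def z(2))
    then show ?thesis using eigenvalue_bordered_le[OF a z(1)[unfolded A] top] True z(2) by simp
  next
    case False
    then have "u = 0" using lower r(1) by (auto simp: u_def)
    then show ?thesis by simp
  qed
  then have "u \<le> 2 * (norm2 a)\<^sup>2 / (\<eta>\<^sub>1 + sqrt (\<eta>\<^sub>1\<^sup>2 + 4 * (norm2 a)\<^sup>2))"
    using \<eta>(2) by (intro le_shift_root) auto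
  then show ?thesis using lower unfolding u_def l_def by simp
qed

end
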